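(* Let $q_0$ be a bounded, strictly positive, even probability density on the circle, let $\Psi$ be a bounded continuous even function on the circle, and for $M\ge0$ let $C=(1,\cos\varphi,\dots,\cos M\varphi)$, $V_M=\mathrm{span}\{1,\cos\varphi,\dots,\cos M\varphi\}$ and let $\Pi_M$ be the orthogonal projection onto $V_M$ in $L^2(q_0)$. Write $DR[q_0u]=\int q_0\,u\,\Psi\,d\varphi$. Then $$\sup\Big\{DR[q_0u]:\ \int q_0uC=0,\ \|u\|_{L^2(q_0)}\le1\Big\}=B_M:=\|(I-\Pi_M)\Psi\|_{L^2(q_0)},$$ $$\sup\Big\{DR[q_0u]:\ \int q_0uC=0,\ \|u\|_\infty\le1\Big\}=D_M:=\inf_{a\in\mathbb R^{M+1}}\int q_0\,|\Psi-a\cdot C|\,d\varphi.$$ Each of $B_M$ and $D_M$ vanishes if and only if $\Psi\in V_M$; $D_M\le B_M$; both $B_M$ and $D_M$ are non-increasing in $M$; and $B_M\to0$ as $M\to\infty$.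
   Context: $L^2(q_0)$ is the $L^2$ space of the circle with weight $q_0$. In the paper, $\Psi$ is the sensitivity density of the interfacial growth rate $R$ (the real part of a simple isolated eigenvalue of the linearisation about a travelling band), $DR[q_0u]$ is the first-order response of $R$ to the kernel perturbation $\delta q=q_0u$, and the constraint $\int q_0uC=0$ expresses that normalisation and the angular rates $\gamma_1,\dots,\gamma_M$ are preserved. Only the representation $DR[q_0u]=\int q_0u\Psi$ is used. *)

theory Defs
  imports "HOL-Analysis.Analysis" "HOL-Probability.Essential_Supremum"
begin

text \<open>
  Functions on the circle are \<open>2 * pi\<close>-periodic functions on the reals; they are measured and
  integrated over one period against (completed) Lebesgue measure, with no \<open>1 / (2 * pi)\<close> factor.
\<close>

abbreviation circle_measure :: "real measure" where
  "circle_measure \<equiv> lebesgue_on {-pi..pi}"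

abbreviation circle_fun :: "(real \<Rightarrow> real) \<Rightarrow> bool" where
  "circle_fun f \<equiv> periodic_fun_simple f (2 * pi)"

definition even_density :: "(real \<Rightarrow> real) \<Rightarrow> bool" where
  "even_density q \<longleftrightarrow>
     circle_fun q \<and> q \<in> borel_measurable circle_measure \<and> bounded (range q) \<and>
     (\<forall>x. 0 < q x) \<and> (\<forall>x. q (- x) = q x) \<and>
     (\<integral>x. q x \<partial>circle_measure) = 1"

definition L2 :: "(real \<Rightarrow> real) \<Rightarrow> (real \<Rightarrow> real) set" where
  "L2 q = {f. circle_fun f \<and> f \<in> borel_measurable circle_measure \<and>
              integrable circle_measure (\<lambda>x. q x * (f x)\<^sup>2)}"

definition L2_inner :: "(real \<Rightarrow> real) \<Rightarrow> (real \<Rightarrow> real) \<Rightarrow> (real \<Rightarrow> real) \<Rightarrow> real" where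
  "L2_inner q f g = (\<integral>x. q x * f x * g x \<partial>circle_measure)"

definition L2_norm :: "(real \<Rightarrow> real) \<Rightarrow> (real \<Rightarrow> real) \<Rightarrow> real" where
  "L2_norm q f = sqrt (L2_inner q f f)"

definition Linf_norm :: "(real \<Rightarrow> real) \<Rightarrow> ereal" where
  "Linf_norm f = esssup circle_measure (\<lambda>x. ereal \<bar>f x\<bar>)"

definition Linf :: "(real \<Rightarrow> real) set" where
  "Linf = {f. circle_fun f \<and> f \<in> borel_measurable circle_measure \<and> Linf_norm f < \<infinity>}"

definition cos_vec :: "nat \<Rightarrow> real \<Rightarrow> real" where
  "cos_vec k x = cos (real k * x)"

text \<open>
  A vector of coefficients indexed by \<open>0, \<dots>, M\<close> is a function on \<^typ>\<open>nat\<close> of which only the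
  values at arguments \<open>\<le> M\<close> are used.
\<close>

definition cos_comb :: "nat \<Rightarrow> (nat \<Rightarrow> real) \<Rightarrow> real \<Rightarrow> real" where
  "cos_comb M a x = (\<Sum>k\<le>M. a k * cos_vec k x)"

definition V :: "nat \<Rightarrow> (real \<Rightarrow> real) set" where
  "V M = range (cos_comb M)"

text \<open>
  For a strictly positive weight, two continuous functions that are equal in \<open>L2 q\<close> are equal
  everywhere, so the class of the projection has exactly one representative in \<^term>\<open>V M\<close>.
\<close>

definition proj_V :: "(real \<Rightarrow> real) \<Rightarrow> nat \<Rightarrow> (real \<Rightarrow> real) \<Rightarrow> real \<Rightarrow> real" where
  "proj_V q M f =
     (THE p. p \<in> V M \<and> (\<forall>v\<in>V M. L2_inner q (\<lambda>x. f x - p x) v = 0))"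

text \<open>
  First-order response, with sensitivity density \<open>\<Psi>\<close>, to the perturbation \<open>\<delta>q\<close>.
\<close>

definition DR :: "(real \<Rightarrow> real) \<Rightarrow> (real \<Rightarrow> real) \<Rightarrow> real" where
  "DR \<Psi> \<delta>q = (\<integral>x. \<delta>q x * \<Psi> x \<partial>circle_measure)"

definition preserves_moments :: "(real \<Rightarrow> real) \<Rightarrow> nat \<Rightarrow> (real \<Rightarrow> real) \<Rightarrow> bool" where
  "preserves_moments q M u \<longleftrightarrow>
     (\<forall>k\<le>M. (\<integral>x. q x * u x * cos_vec k x \<partial>circle_measure) = 0)"

definition B :: "(real \<Rightarrow> real) \<Rightarrow> (real \<Rightarrow> real) \<Rightarrow> nat \<Rightarrow> real" where
  "B q \<Psi> M = L2_norm q (\<lambda>x. \<Psi> x - proj_V q M \<Psi> x)"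

definition D :: "(real \<Rightarrow> real) \<Rightarrow> (real \<Rightarrow> real) \<Rightarrow> nat \<Rightarrow> real" where
  "D q \<Psi> M = (INF a. \<integral>x. q x * \<bar>\<Psi> x - cos_comb M a x\<bar> \<partial>circle_measure)"

end

theory Submission
  imports Defs
begin

text \<open>
  On the unit ball of \<open>L\<^sup>2(q)\<close> or of \<open>L\<^sup>\<infinity>\<close>, subject to the moment constraints, the response
  \<open>\<integral> q u \<Psi>\<close> does not change when an element of \<open>V\<^sub>M\<close> is subtracted from \<open>\<Psi>\<close>. So every distance from
  \<open>\<Psi>\<close> to a point of \<open>V\<^sub>M\<close>, in the dual norm, bounds the supremum from above. The content of the two
  duality formulas is the opposite inequality: there must be feasible \<open>u\<close> that nearly align with a
  best residual.
  
  Both such \<open>u\<close> come from one variational principle (\<open>residual_with_vanishing_moments\<close>). Minimise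
  \<open>a \<mapsto> \<integral> q \<phi>(\<Psi> - a \<cdot> C)\<close> for a smooth coercive \<open>\<phi>\<close>; at a minimiser the partial derivatives vanish,
  which says exactly that \<open>u = \<phi>'(\<Psi> - a \<cdot> C)\<close> preserves the moments.
  
  \<^item> For \<open>\<phi>(t) = t\<^sup>2\<close> this constructs the orthogonal projection, and the normalised residual attains
    the \<open>L\<^sup>2\<close> supremum.
  
  \<^item> For \<open>\<phi>(t) = sqrt (\<epsilon>\<^sup>2 + t\<^sup>2)\<close>, a smooth substitute for \<open>\<bar>t\<bar>\<close>, one gets \<open>\<bar>u\<bar> \<le> 1\<close> and
    \<open>t \<phi>'(t) \<ge> \<bar>t\<bar> - \<epsilon>\<close>, so the response to \<open>u\<close> is at least \<open>D\<^sub>M - \<epsilon>\<close>. Working with \<open>\<bar>t\<bar>\<close> itself and the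
    sign of a best residual would fail when the residual vanishes on a set of positive measure;
    smoothing replaces the Hahn--Banach theorem.
  
  Minimisers exist because \<open>\<integral> q \<bar>a \<cdot> C\<bar>\<close> is a norm on the coefficients (\<open>coefficients_coercive\<close>), which
  needs the linear independence of the cosines and the strict positivity of \<open>q\<close>.
  
  The remaining claims follow. Feasible sets shrink as \<open>M\<close> grows, which gives monotonicity. A zero
  distance is attained by some \<open>v \<in> V\<^sub>M\<close> with \<open>\<Psi> = v\<close> almost everywhere, hence everywhere by continuity.
  The inequality \<open>D\<^sub>M \<le> B\<^sub>M\<close> is Cauchy--Schwarz for a probability density. Finally \<open>B\<^sub>M \<rightarrow> 0\<close> since
  \<open>\<Psi>(x) = g(cos x)\<close> with \<open>g\<close> continuous, and by Weierstrass \<open>g\<close> is uniformly close to a polynomial, whose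
  composition with the cosine lies in some \<open>V\<^sub>N\<close> (\<open>V_dense_even\<close>).
\<close>

section \<open>Cosine sums\<close>

lemma cos_comb_zero [simp]: "cos_comb M (\<lambda>k. 0) x = 0"
  by (simp add: cos_comb_def)

lemma cos_comb_add_scaled:
  "cos_comb M (\<lambda>k. a k + t * b k) x = cos_comb M a x + t * cos_comb M b x"
  by (simp add: cos_comb_def sum.distrib sum_distrib_left algebra_simps)

lemma cos_comb_scaled: "cos_comb M (\<lambda>k. t * b k) x = t * cos_comb M b x"
  using cos_comb_add_scaled[of M "\<lambda>_. 0" t b x] by simp

lemma cos_comb_unit:
  assumes "k \<le> M" shows "cos_comb M (\<lambda>j. if j = k then 1 else 0) x = cos_vec k x"
  using assms by (simp add: cos_comb_def if_distrib[where f = "\<lambda>z. z * _"] sum.delta cong: if_cong)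

lemma cos_comb_cong: "(\<And>k. k \<le> M \<Longrightarrow> a k = b k) \<Longrightarrow> cos_comb M a x = cos_comb M b x"
  by (simp add: cos_comb_def)

lemma abs_cos_comb_le: "\<bar>cos_comb M a x\<bar> \<le> (\<Sum>k\<le>M. \<bar>a k\<bar>)"
proof -
  have "\<bar>cos_comb M a x\<bar> \<le> (\<Sum>k\<le>M. \<bar>a k * cos_vec k x\<bar>)"
    unfolding cos_comb_def by (rule sum_abs)
  also have "\<dots> \<le> (\<Sum>k\<le>M. \<bar>a k\<bar>)"
    by (intro sum_mono) (simp add: cos_vec_def abs_mult mult_left_le)
  finally show ?thesis .
qed

lemma continuous_on_cos_vec [continuous_intros]: "continuous_on S (cos_vec k)"
  unfolding cos_vec_def by (intro continuous_intros)

lemma continuous_on_cos_comb [continuous_intros]: "continuous_on S (cos_comb M a)"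
  unfolding cos_comb_def cos_vec_def by (intro continuous_intros)

lemma measurable_circle_of_continuous:
  fixes f :: "real \<Rightarrow> real"
  assumes "continuous_on UNIV f" shows "f \<in> borel_measurable circle_measure"
  using assms by (intro continuous_imp_measurable_on_sets_lebesgue)
    (auto intro: continuous_on_subset)

lemma measurable_cos_vec [measurable]: "cos_vec k \<in> borel_measurable circle_measure"
  by (intro measurable_circle_of_continuous continuous_intros)

lemma measurable_cos_comb [measurable]: "cos_comb M a \<in> borel_measurable circle_measure"
  by (intro measurable_circle_of_continuous continuous_intros)

lemma circle_fun_iff: "circle_fun f \<longleftrightarrow> (\<forall>x. f (x + 2 * pi) = f x)"
  by (simp add: periodic_fun_simple_def)

lemma circle_fun_cos_comb: "circle_fun (cos_comb M a)"
proof -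
  have "cos_vec k (x + 2 * pi) = cos_vec k x" for k x
    using cos.plus_of_nat[of "real k * x" k] by (simp add: cos_vec_def algebra_simps)
  then show ?thesis by (simp add: circle_fun_iff cos_comb_def)
qed

text \<open>
  Linear independence of the cosines without integrals: the operator
  \<open>f \<mapsto> f(\<cdot> + h) + f(\<cdot> - h)\<close> multiplies the \<open>k\<close>-th cosine by \<open>2 cos (k h)\<close>. When \<open>M + 1\<close>
  is the top frequency and \<open>h = pi / (M + 1)\<close>, adding \<open>2 f\<close> to the result kills the top term and no
  other, which lowers the degree.
\<close>
lemma cos_comb_eq_0_imp:
  assumes "\<And>x. cos_comb M a x = 0" "k \<le> M" shows "a k = 0"
  using assms
proof (induction M arbitrary: a k)
  case 0
  then show ?case by (simp add: cos_comb_def cos_vec_def)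
next
  case (Suc M)
  have low: "a j = 0" if "j \<le> M" for j
  proof -
    define h where "h = pi / real (Suc M)"
    have shift: "(\<Sum>i\<le>Suc M. a i * cos (real i * h) * cos_vec i x) = 0" for x
    proof -
      have "2 * (\<Sum>i\<le>Suc M. a i * cos (real i * h) * cos_vec i x)
              = cos_comb (Suc M) a (x + h) + cos_comb (Suc M) a (x - h)"
        unfolding cos_comb_def cos_vec_def sum_distrib_left sum.distrib[symmetric]
        by (intro sum.cong refl) (simp add: cos_add cos_diff algebra_simps)
      then show ?thesis using Suc.prems(1) by simp
    qed
    have top: "cos (real (Suc M) * h) = - 1"
      unfolding h_def by (simp del: of_nat_Suc)
    have "cos_comb M (\<lambda>i. a i * (cos (real i * h) + 1)) x = 0" for x
    proof -
      have "(\<Sum>i\<le>Suc M. a i * (cos (real i * h) + 1) * cos_vec i x)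
              = (\<Sum>i\<le>Suc M. a i * cos (real i * h) * cos_vec i x) + cos_comb (Suc M) a x"
        unfolding cos_comb_def sum.distrib[symmetric]
        by (intro sum.cong refl) (simp add: algebra_simps)
      also have "\<dots> = 0" using shift Suc.prems(1) by simp
      finally show ?thesis using top by (simp add: cos_comb_def del: of_nat_Suc)
    qed
    then have "a j * (cos (real j * h) + 1) = 0" using Suc.IH that by blast
    moreover have "cos pi < cos (real j * h)"
    proof (intro cos_monotone_0_pi)
      have "pi * real j < pi * real (Suc M)" using that by (intro mult_strict_left_mono) auto
      then show "real j * h < pi" by (simp add: h_def field_simps)
    qed (simp_all add: h_def)
    ultimately show ?thesis by simp
  qed
  then have "cos_comb (Suc M) a 0 = a (Suc M)"
    by (simp add: cos_comb_def cos_vec_def)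
  with Suc.prems(1) have "a (Suc M) = 0" by simp
  with low Suc.prems(2) show ?case by (metis le_Suc_eq)
qed

lemma cos_comb_in_V: "cos_comb M a \<in> V M"
  by (simp add: V_def)

lemma V_mono: assumes "v \<in> V M" "M \<le> N" shows "v \<in> V N"
proof -
  obtain a where v: "v = cos_comb M a" using assms(1) by (auto simp: V_def)
  have "cos_comb N (\<lambda>k. if k \<le> M then a k else 0) x = v x" for x
    unfolding v cos_comb_def using assms(2) by (intro sum.mono_neutral_cong_right) auto
  then show ?thesis by (metis cos_comb_in_V ext)
qed

lemma V_add_scaled: assumes "v \<in> V M" "w \<in> V M" shows "(\<lambda>x. v x + t * w x) \<in> V M"
proof -
  obtain a b where "v = cos_comb M a" "w = cos_comb M b" using assms by (auto simp: V_def)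
  then have "(\<lambda>x. v x + t * w x) = cos_comb M (\<lambda>k. a k + t * b k)"
    by (simp add: cos_comb_add_scaled fun_eq_iff)
  then show ?thesis by (simp add: cos_comb_in_V)
qed

lemma V_zero: "(\<lambda>x. 0) \<in> V M"
proof -
  have "(\<lambda>x. 0) = cos_comb M (\<lambda>k. 0)" by (simp add: fun_eq_iff)
  then show ?thesis by (simp only: cos_comb_in_V)
qed

lemma V_sum:
  fixes n :: nat
  assumes "\<And>i. i \<le> n \<Longrightarrow> f i \<in> V M"
  shows "(\<lambda>x. \<Sum>i\<le>n. c i * f i x) \<in> V M"
proof -
  have "m \<le> Suc n \<Longrightarrow> (\<lambda>x. \<Sum>i<m. c i * f i x) \<in> V M" for m
  proof (induction m)
    case (Suc m)
    then show ?case using V_add_scaled[OF Suc.IH assms, of m "c m"] by simp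
  qed (simp add: V_zero)
  from this[of "Suc n"] show ?thesis by (simp add: lessThan_Suc_atMost)
qed

lemma cos_vec_in_V: "k \<le> M \<Longrightarrow> cos_vec k \<in> V M"
  using cos_comb_unit cos_comb_in_V by (metis ext)

lemma cos_times_V: assumes "v \<in> V M" shows "(\<lambda>x. cos x * v x) \<in> V (Suc M)"
proof -
  have one: "(\<lambda>x. cos x * cos_vec k x) \<in> V (Suc M)" if "k \<le> M" for k
  proof -
    have "(\<lambda>x. (\<lambda>x. 0 + 1/2 * cos_vec (Suc k) x) x
                 + 1/2 * cos_vec (if k = 0 then 1 else k - 1) x) \<in> V (Suc M)"
      using that by (intro V_add_scaled cos_vec_in_V V_zero) auto
    moreover have "cos x * cos_vec k x
        = 1/2 * cos_vec (Suc k) x + 1/2 * cos_vec (if k = 0 then 1 else k - 1) x" for x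
    proof (cases k)
      case (Suc j)
      have "cos_vec (Suc k) x = cos (real k * x) * cos x - sin (real k * x) * sin x"
        using cos_add[of "real k * x" x] by (simp add: cos_vec_def algebra_simps)
      moreover have "cos_vec j x = cos (real k * x) * cos x + sin (real k * x) * sin x"
        using cos_diff[of "real k * x" x] by (simp add: cos_vec_def Suc algebra_simps)
      moreover have "cos x * cos_vec k x = cos (real k * x) * cos x"
        by (simp add: cos_vec_def)
      moreover have "(if k = 0 then 1 else k - 1) = j" using Suc by simp
      ultimately show ?thesis by (simp only:) (simp add: field_simps)
    qed (simp add: cos_vec_def)
    ultimately show ?thesis by simp
  qed
  obtain a where v: "v = cos_comb M a" using assms by (auto simp: V_def)
  have "(\<lambda>x. \<Sum>k\<le>M. a k * (cos x * cos_vec k x)) \<in> V (Suc M)"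
    using one by (rule V_sum)
  also have "(\<lambda>x. \<Sum>k\<le>M. a k * (cos x * cos_vec k x)) = (\<lambda>x. cos x * v x)"
    by (simp add: v cos_comb_def sum_distrib_left mult.left_commute)
  finally show ?thesis .
qed

text \<open>
  An even function on \<open>[-pi, pi]\<close> is a function of \<open>cos x\<close>, so uniform approximation by \<open>V\<close> is
  polynomial approximation on \<open>[-1, 1]\<close>.
\<close>
lemma V_dense_even:
  fixes f :: "real \<Rightarrow> real"
  assumes cont: "continuous_on UNIV f" and even: "\<And>x. f (- x) = f x" and "\<epsilon> > 0"
  obtains M v where "v \<in> V M" "\<And>x. x \<in> {-pi..pi} \<Longrightarrow> \<bar>f x - v x\<bar> < \<epsilon>"
proof -
  have "continuous_on {-1..1} (\<lambda>t. f (arccos t))"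
    using cont by (auto intro!: continuous_on_compose2[of UNIV f] continuous_intros)
  then obtain g where g: "real_polynomial_function g"
    and gf: "\<And>t. t \<in> {-1..1} \<Longrightarrow> \<bar>f (arccos t) - g t\<bar> < \<epsilon>"
    using Stone_Weierstrass_real_polynomial_function[of "{-1..1::real}" "\<lambda>t. f (arccos t)" \<epsilon>]
      \<open>\<epsilon> > 0\<close>
    by auto
  obtain c N where gN: "g = (\<lambda>t. \<Sum>i\<le>N. c i * t ^ i)"
    using g by (auto simp: real_polynomial_function_iff_sum)
  have pow: "(\<lambda>x. cos x ^ n) \<in> V n" for n
  proof (induction n)
    case 0
    have "cos_comb 0 (\<lambda>_. 1) = (\<lambda>x. cos x ^ 0)" by (simp add: cos_comb_def cos_vec_def fun_eq_iff)
    then show ?case by (metis cos_comb_in_V)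
  next
    case (Suc n)
    then show ?case using cos_times_V by fastforce
  qed
  have "(\<lambda>x. g (cos x)) \<in> V N"
    unfolding gN using V_mono[OF pow] by (rule V_sum)
  moreover have "\<bar>f x - g (cos x)\<bar> < \<epsilon>" if "x \<in> {-pi..pi}" for x
  proof -
    have "f (arccos (cos x)) = f x"
      using that even arccos_cos[of "\<bar>x\<bar>"] by (cases "x \<ge> 0") auto
    then show ?thesis using gf[of "cos x"] by simp
  qed
  ultimately show ?thesis using that by blast
qed

text \<open>
  The passage from \<open>[-pi, pi]\<close> to the real line uses periodicity; the endpoints are reached through
  the closure of the open interval.
\<close>
lemma continuous_AE_zero_circle:
  fixes f :: "real \<Rightarrow> real"
  assumes per: "circle_fun f" and cont: "continuous_on UNIV f"
    and zero: "AE x in circle_measure. f x = 0"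
  shows "f x = 0"
proof -
  have cl: "closed {x. f x = 0}"
    using cont continuous_closed_vimage[of "{0}" f]
    by (auto simp: vimage_def continuous_on_eq_continuous_at)
  have "AE x in lebesgue. x \<in> {-pi<..<pi} \<longrightarrow> x \<in> {x. f x = 0}"
    using zero by (auto simp: AE_restrict_space_iff elim!: eventually_mono)
  then have "{-pi<..<pi} \<subseteq> {x. f x = 0}"
    using mem_closed_if_AE_lebesgue_open[of "{-pi<..<pi}" "{x. f x = 0}"] cl by auto
  then have "closure {-pi<..<pi} \<subseteq> {x. f x = 0}"
    by (rule closure_minimal) (rule cl)
  then have *: "f y = 0" if "y \<in> {-pi..pi}" for y
    using that by (auto simp: closure_greaterThanLessThan)
  interpret periodic_fun_simple f "2 * pi" by (rule per)
  define n where "n = \<lfloor>(x + pi) / (2 * pi)\<rfloor>"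
  have "of_int n \<le> (x + pi) / (2 * pi)" "(x + pi) / (2 * pi) < of_int n + 1"
    unfolding n_def by linarith+
  then have "x - of_int n * (2 * pi) \<in> {-pi..pi}" by (auto simp: field_simps)
  then show ?thesis using * minus_of_int[of x n] by metis
qed

section \<open>Compactness and elementary estimates\<close>

text \<open>
  Coefficient vectors are functions on \<^typ>\<open>nat\<close>, with the product topology, so that boxes are compact by
  Tychonoff for every \<open>M\<close> at once.
\<close>
lemma compact_coefficient_box: "compact {a :: nat \<Rightarrow> real. \<forall>k. \<bar>a k\<bar> \<le> R}"
proof -
  have "{a :: nat \<Rightarrow> real. \<forall>k. \<bar>a k\<bar> \<le> R} = PiE UNIV (\<lambda>_. {-R..R})"
    by (auto simp: PiE_def Pi_def abs_le_iff minus_le_iff)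
  moreover have "compactin (product_topology (\<lambda>_. euclidean) UNIV) (PiE UNIV (\<lambda>_::nat. {-R..R}))"
    by (simp add: compactin_PiE)
  ultimately show ?thesis by (simp add: euclidean_product_topology)
qed

lemma preserves_moments_antimono: "preserves_moments q N u \<Longrightarrow> M \<le> N \<Longrightarrow> preserves_moments q M u"
  by (simp add: preserves_moments_def)

lemma measurable_comp_continuous:
  assumes "continuous_on UNIV (\<phi> :: real \<Rightarrow> real)" "f \<in> borel_measurable M"
  shows "(\<lambda>x. \<phi> (f x)) \<in> borel_measurable M"
  using measurable_compose[OF assms(2) borel_measurable_continuous_onI[OF assms(1)]] .

lemma continuous_bounded_on_interval:
  assumes "continuous_on UNIV (\<phi> :: real \<Rightarrow> real)"
  obtains C where "\<And>t. \<bar>t\<bar> \<le> T \<Longrightarrow> \<bar>\<phi> t\<bar> \<le> C"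
proof -
  have "bounded (\<phi> ` {-T..T})"
    using assms by (intro compact_imp_bounded compact_continuous_image)
      (auto intro: continuous_on_subset)
  then show ?thesis using that by (force simp: bounded_iff abs_le_iff)
qed

lemma abs_residual_le:
  assumes "\<bar>f x :: real\<bar> \<le> K" "\<And>k. \<bar>a k\<bar> \<le> R"
  shows "\<bar>f x - cos_comb M a x\<bar> \<le> K + (real M + 1) * R"
proof -
  have "(\<Sum>k\<le>M. \<bar>a k\<bar>) \<le> (\<Sum>k\<le>M. R)" by (intro sum_mono assms)
  then show ?thesis using abs_cos_comb_le[of M a x] assms(1) by (simp add: algebra_simps)
qed

text \<open>
  First-order optimality: a slope that is dominated by a quadratic error in both directions is zero.
\<close>
lemma linear_le_square_imp_0:
  assumes "\<And>t::real. t * I \<le> L * t\<^sup>2" shows "I = 0"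
proof -
  define s where "s = I / (\<bar>L\<bar> + 1)"
  have I: "I = s * (\<bar>L\<bar> + 1)" by (simp add: s_def)
  have "s * I \<le> \<bar>L\<bar> * s\<^sup>2" using assms[of s] by (smt (verit) mult_right_mono zero_le_power2)
  then have "s\<^sup>2 \<le> 0" by (simp add: I power2_eq_square algebra_simps)
  then show ?thesis by (simp add: I)
qed

text \<open>
  The tangent of the concave square root at \<open>e\<^sup>2 + s\<^sup>2\<close> bounds the left side; the quadratic term of the
  increment is then estimated with \<open>sqrt (e\<^sup>2 + s\<^sup>2) \<ge> e\<close>. The constant \<open>1 / (2 e)\<close> blows up as
  \<open>e\<close> tends to 0, which is harmless because optimality conditions only need some constant.
\<close>
lemma sqrt_smoothing_descent:
  fixes e s h :: real
  assumes "e > 0"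
  shows "sqrt (e\<^sup>2 + (s + h)\<^sup>2)
           \<le> sqrt (e\<^sup>2 + s\<^sup>2) + h * (s / sqrt (e\<^sup>2 + s\<^sup>2)) + 1 / (2 * e) * h\<^sup>2"
proof -
  define S where "S = sqrt (e\<^sup>2 + s\<^sup>2)"
  have S2: "S\<^sup>2 = e\<^sup>2 + s\<^sup>2" by (simp add: S_def)
  have eS: "e \<le> S" unfolding S_def by (rule real_le_rsqrt) simp
  then have S: "S > 0" using assms by linarith
  define d where "d = 2 * h * s + h\<^sup>2"
  have d: "e\<^sup>2 + (s + h)\<^sup>2 = S\<^sup>2 + d"
    unfolding S2 d_def by (simp add: power2_sum)
  then have nn: "0 \<le> S\<^sup>2 + d" by (metis add_nonneg_nonneg zero_le_power2)
  have "sqrt (S\<^sup>2 + d) \<le> S + d / (2 * S)"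
  proof (rule real_le_lsqrt)
    have "S + d / (2 * S) = (S\<^sup>2 + (S\<^sup>2 + d)) / (2 * S)"
      using S by (simp add: field_simps power2_eq_square)
    then show "0 \<le> S + d / (2 * S)"
      using S nn by (metis add_nonneg_nonneg divide_nonneg_pos mult_pos_pos zero_le_power2 zero_less_numeral)
    have "(S + d / (2 * S))\<^sup>2 = S\<^sup>2 + d + (d / (2 * S))\<^sup>2"
      using S by (simp add: power2_sum)
    then show "S\<^sup>2 + d \<le> (S + d / (2 * S))\<^sup>2" by simp
  qed
  also have "\<dots> = S + h * (s / S) + 1 / (2 * S) * h\<^sup>2"
    using S by (simp add: d_def field_simps)
  also have "\<dots> \<le> S + h * (s / S) + 1 / (2 * e) * h\<^sup>2"
    using eS assms by (intro add_left_mono mult_right_mono) (simp_all add: frac_le)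
  finally show ?thesis unfolding d S_def[symmetric] .
qed

section \<open>Integration against the weight\<close>

context
  fixes q :: "real \<Rightarrow> real"
  assumes q: "even_density q"
begin

lemma measurable_weight [measurable]: "q \<in> borel_measurable circle_measure"
  using q by (simp add: even_density_def)

lemma weight_pos: "0 < q x"
  using q by (simp add: even_density_def)

lemma weight_integral: "(\<integral>x. q x \<partial>circle_measure) = 1"
  using q by (simp add: even_density_def)

lemma weight_integrable: "integrable circle_measure q"
  using weight_integral not_integrable_integral_eq by fastforce

lemma integrable_weight_bounded:
  assumes [measurable]: "f \<in> borel_measurable circle_measure"
    and bnd: "AE x in circle_measure. \<bar>f x\<bar> \<le> K"
  shows "integrable circle_measure (\<lambda>x. q x * f x)"
proof (rule Bochner_Integration.integrable_bound)
  show "integrable circle_measure (\<lambda>x. K * q x)"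
    using weight_integrable by simp
  show "AE x in circle_measure. norm (q x * f x) \<le> norm (K * q x)"
    using bnd
  proof eventually_elim
    case (elim x)
    then show ?case using weight_pos[of x] by (simp add: abs_mult mult.commute mult_right_mono)
  qed
qed simp

lemma weight_integral_bound:
  assumes "f \<in> borel_measurable circle_measure" "\<And>x. x \<in> {-pi..pi} \<Longrightarrow> \<bar>f x\<bar> \<le> K"
  shows "(\<integral>x. q x * f x \<partial>circle_measure) \<le> K"
proof -
  have ae: "AE x in circle_measure. \<bar>f x\<bar> \<le> K"
    using assms(2) by (intro AE_I2) simp
  have "(\<integral>x. q x * f x \<partial>circle_measure) \<le> (\<integral>x. K * q x \<partial>circle_measure)"
  proof (rule integral_mono)
    fix x assume "x \<in> space circle_measure"
    then have "f x \<le> K" using assms(2)[of x] by auto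
    then show "q x * f x \<le> K * q x" using weight_pos[of x] by (simp add: mult.commute)
  qed (use weight_integrable integrable_weight_bounded[OF assms(1) ae] in simp_all)
  then show ?thesis by (simp add: weight_integral)
qed

lemma weight_integral_abs_nonneg: "0 \<le> (\<integral>x. q x * \<bar>g x\<bar> \<partial>circle_measure)"
  using weight_pos by (intro integral_nonneg_AE AE_I2) (simp add: less_imp_le)

lemma weight_integral_eq_0D:
  assumes "circle_fun f" "continuous_on UNIV f"
    and int: "integrable circle_measure (\<lambda>x. q x * f x)" and nn: "\<And>x. 0 \<le> f x"
    and z: "(\<integral>x. q x * f x \<partial>circle_measure) = 0"
  shows "f x = 0"
proof -
  have "AE x in circle_measure. q x * f x = 0"
    using integral_nonneg_eq_0_iff_AE[OF int] z nn weight_pos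
    by (simp add: less_imp_le)
  then have "AE x in circle_measure. f x = 0"
    by eventually_elim (use weight_pos in \<open>simp add: less_imp_neq[symmetric]\<close>)
  then show ?thesis using continuous_AE_zero_circle assms(1,2) by blast
qed

section \<open>Minimising a cost over the coefficients\<close>

lemma integrable_cost:
  assumes "continuous_on UNIV (\<phi> :: real \<Rightarrow> real)"
    and "f \<in> borel_measurable circle_measure" "\<And>x. \<bar>f x\<bar> \<le> K"
    and "g \<in> borel_measurable circle_measure" "\<And>x. \<bar>g x\<bar> \<le> K'"
  shows "integrable circle_measure (\<lambda>x. q x * (\<phi> (f x - cos_comb M a x) * g x))"
proof -
  have "\<bar>f x - cos_comb M a x\<bar> \<le> K + (\<Sum>k\<le>M. \<bar>a k\<bar>)" for x
    using abs_cos_comb_le[of M a x] assms(3)[of x] by linarith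
  moreover obtain C where "\<And>t. \<bar>t\<bar> \<le> K + (\<Sum>k\<le>M. \<bar>a k\<bar>) \<Longrightarrow> \<bar>\<phi> t\<bar> \<le> C"
    using continuous_bounded_on_interval[OF assms(1)] by metis
  ultimately have "\<bar>\<phi> (f x - cos_comb M a x) * g x\<bar> \<le> C * K'" for x
    unfolding abs_mult using assms(5)[of x] by (intro mult_mono) (auto intro: order_trans[OF abs_ge_zero])
  moreover have "(\<lambda>x. \<phi> (f x - cos_comb M a x) * g x) \<in> borel_measurable circle_measure"
    using assms(2,4) by (intro borel_measurable_times measurable_comp_continuous[OF assms(1)]) auto
  ultimately show ?thesis by (intro integrable_weight_bounded) auto
qed

text \<open>
  On a box the residuals are uniformly bounded, so dominated convergence applies with a multiple of
  the weight as the dominating function.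
\<close>
lemma continuous_cost:
  assumes \<phi>: "continuous_on UNIV (\<phi> :: real \<Rightarrow> real)"
    and f: "f \<in> borel_measurable circle_measure" "\<And>x. \<bar>f x\<bar> \<le> K"
  shows "continuous_on {a. \<forall>k. \<bar>a k\<bar> \<le> R}
           (\<lambda>a. \<integral>x. q x * \<phi> (f x - cos_comb M a x) \<partial>circle_measure)"
proof (rule continuous_on_sequentiallyI)
  fix u :: "nat \<Rightarrow> nat \<Rightarrow> real" and a
  assume u: "\<forall>n. u n \<in> {a. \<forall>k. \<bar>a k\<bar> \<le> R}" and lim: "u \<longlonglongrightarrow> a"
  have coord: "(\<lambda>n. u n k) \<longlonglongrightarrow> a k" for k
    using continuous_on_tendsto_compose[OF continuous_on_product_coordinates[of k] lim] by simp
  obtain C where C: "\<And>t. \<bar>t\<bar> \<le> K + (real M + 1) * R \<Longrightarrow> \<bar>\<phi> t\<bar> \<le> C"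
    using continuous_bounded_on_interval[OF \<phi>] by metis
  have meas: "(\<lambda>x. q x * \<phi> (f x - cos_comb M b x)) \<in> borel_measurable circle_measure" for b
    using f(1) by (intro borel_measurable_times measurable_comp_continuous[OF \<phi>]) auto
  show "(\<lambda>n. \<integral>x. q x * \<phi> (f x - cos_comb M (u n) x) \<partial>circle_measure)
          \<longlonglongrightarrow> (\<integral>x. q x * \<phi> (f x - cos_comb M a x) \<partial>circle_measure)"
  proof (rule integral_dominated_convergence[where w = "\<lambda>x. C * q x"])
    show "integrable circle_measure (\<lambda>x. C * q x)" using weight_integrable by simp
    have "(\<lambda>n. q x * \<phi> (f x - cos_comb M (u n) x)) \<longlonglongrightarrow> q x * \<phi> (f x - cos_comb M a x)" for x
    proof -
      have "(\<lambda>n. f x - cos_comb M (u n) x) \<longlonglongrightarrow> f x - cos_comb M a x"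
        unfolding cos_comb_def by (intro tendsto_intros coord)
      then show ?thesis
        using continuous_on_tendsto_compose[OF \<phi>] by (intro tendsto_intros) auto
    qed
    then show "AE x in circle_measure. (\<lambda>n. q x * \<phi> (f x - cos_comb M (u n) x))
                 \<longlonglongrightarrow> q x * \<phi> (f x - cos_comb M a x)" by simp
    have "\<bar>\<phi> (f x - cos_comb M (u n) x)\<bar> \<le> C" for n x
      using u by (intro C abs_residual_le f) auto
    then have "norm (q x * \<phi> (f x - cos_comb M (u n) x)) \<le> C * q x" for n x
      using weight_pos[of x] by (simp add: abs_mult mult.commute)
    then show "AE x in circle_measure. norm (q x * \<phi> (f x - cos_comb M (u n) x)) \<le> C * q x" for n
      by simp
  qed (rule meas)+
qed

text \<open>
  The weighted \<open>L\<^sup>1\<close> norm of \<open>a \<cdot> C\<close> is positive on the compact unit sphere of the maximum norm, since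
  otherwise a nontrivial cosine sum would vanish; \<open>c\<close> is its minimum there, and homogeneity does the
  rest. A weight that is merely positive, not bounded below, gives no explicit constant.
\<close>
lemma coefficients_coercive:
  obtains c where "c > 0"
    "\<And>a k. k \<le> M \<Longrightarrow> c * \<bar>a k\<bar> \<le> (\<integral>x. q x * \<bar>cos_comb M a x\<bar> \<partial>circle_measure)"
proof -
  define G where "G a = (\<integral>x. q x * \<bar>cos_comb M a x\<bar> \<partial>circle_measure)" for a
  \<comment> \<open>Only the coordinates up to \<open>M\<close> enter the sum, so one of these has to have modulus 1.\<close>
  define S where "S = {a. \<forall>k. \<bar>a k :: real\<bar> \<le> 1} \<inter> (\<Union>k\<le>M. {a. \<bar>a k\<bar> = 1})"
  have "closed {a :: nat \<Rightarrow> real. \<bar>a k\<bar> = 1}" for k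
    by (intro closed_Collect_eq continuous_intros) auto
  then have comp: "compact S"
    unfolding S_def by (intro compact_Int_closed compact_coefficient_box closed_UN) auto
  have "(\<lambda>_. 1) \<in> S" by (auto simp: S_def)
  moreover have "continuous_on S G"
    unfolding G_def using continuous_cost[of abs "\<lambda>_. 0" 0 1 M]
    by (auto simp: S_def continuous_on_rabs continuous_on_id intro: continuous_on_subset)
  ultimately obtain a0 where a0: "a0 \<in> S" "\<And>b. b \<in> S \<Longrightarrow> G a0 \<le> G b"
    using continuous_attains_inf[OF comp, of G] by auto
  have intG: "integrable circle_measure (\<lambda>x. q x * \<bar>cos_comb M b x\<bar>)" for b
    using abs_cos_comb_le[of M b] by (intro integrable_weight_bounded) auto
  have "G b \<ge> 0" for b
    unfolding G_def by (intro integral_nonneg_AE AE_I2) (simp add: weight_pos less_imp_le)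
  moreover have "G a0 \<noteq> 0"
  proof
    assume "G a0 = 0"
    then have "\<bar>cos_comb M a0 x\<bar> = 0" for x
      using circle_fun_cos_comb[of M a0]
      by (intro weight_integral_eq_0D[of "\<lambda>x. \<bar>cos_comb M a0 x\<bar>"] intG)
        (auto simp: G_def circle_fun_iff intro!: continuous_intros)
    then have "a0 k = 0" if "k \<le> M" for k using cos_comb_eq_0_imp that by auto
    then show False using a0(1) by (auto simp: S_def)
  qed
  ultimately have pos: "G a0 > 0" by (metis less_eq_real_def)
  have "G a0 * \<bar>a k\<bar> \<le> G a" if k: "k \<le> M" for a k
  proof -
    define m where "m = Max ((\<lambda>j. \<bar>a j\<bar>) ` {..M})"
    have le: "\<bar>a j\<bar> \<le> m" if "j \<le> M" for j unfolding m_def using that by auto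
    have "m \<in> (\<lambda>j. \<bar>a j\<bar>) ` {..M}" unfolding m_def by (intro Max_in) auto
    then obtain i where i: "i \<le> M" "\<bar>a i\<bar> = m" by auto
    show ?thesis
    proof (cases "m = 0")
      case True
      then show ?thesis using le[OF k] \<open>\<And>b. G b \<ge> 0\<close> by simp
    next
      case False
      then have m: "m > 0" using i by auto
      define b where "b j = (if j \<le> M then a j / m else 0)" for j
      have "b \<in> S" using le i m by (auto simp: S_def b_def)
      then have "G a0 * m \<le> G b * m" using a0(2) m by simp
      moreover have "G a = m * G b"
      proof -
        have "cos_comb M a x = m * cos_comb M b x" for x
          unfolding cos_comb_scaled[symmetric] using m by (intro cos_comb_cong) (simp add: b_def)
        then show ?thesis using m by (simp add: G_def abs_mult algebra_simps flip: integral_mult_right_zero)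
      qed
      moreover have "G a0 * \<bar>a k\<bar> \<le> G a0 * m" using le[OF k] pos by simp
      ultimately show ?thesis by (simp add: mult.commute)
    qed
  qed
  with pos that show ?thesis unfolding G_def by blast
qed

text \<open>
  Coercivity forces the cost outside a large box above its value at \<open>a = 0\<close>, so the minimum over the
  compact box is global. The case \<open>\<phi> = abs\<close> gives best \<open>L\<^sup>1\<close> approximations.
\<close>
lemma cost_attains_min:
  assumes \<phi>: "continuous_on UNIV (\<phi> :: real \<Rightarrow> real)" and coerc: "\<And>t. \<bar>t\<bar> - K' \<le> \<phi> t"
    and f: "f \<in> borel_measurable circle_measure" "\<And>x. \<bar>f x\<bar> \<le> K"
  obtains a where "\<And>b. (\<integral>x. q x * \<phi> (f x - cos_comb M a x) \<partial>circle_measure)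
                     \<le> (\<integral>x. q x * \<phi> (f x - cos_comb M b x) \<partial>circle_measure)"
proof -
  define F where "F a = (\<integral>x. q x * \<phi> (f x - cos_comb M a x) \<partial>circle_measure)" for a
  obtain c where c: "c > 0"
    "\<And>a k. k \<le> M \<Longrightarrow> c * \<bar>a k\<bar> \<le> (\<integral>x. q x * \<bar>cos_comb M a x\<bar> \<partial>circle_measure)"
    using coefficients_coercive by metis
  have lower: "c * \<bar>b k\<bar> - (K + K') \<le> F b" if "k \<le> M" for b k
  proof -
    have i1: "integrable circle_measure (\<lambda>x. q x * \<bar>cos_comb M b x\<bar>)"
      using abs_cos_comb_le[of M b] by (intro integrable_weight_bounded) auto
    have i2: "integrable circle_measure (\<lambda>x. q x * \<phi> (f x - cos_comb M b x))"
      using integrable_cost[OF \<phi> f, of "\<lambda>_. 1" 1 M b] by simp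
    have "(\<integral>x. q x * \<bar>cos_comb M b x\<bar> \<partial>circle_measure) - (K + K')
            = (\<integral>x. q x * \<bar>cos_comb M b x\<bar> - (K + K') * q x \<partial>circle_measure)"
      using i1 weight_integrable weight_integral by simp
    also have "\<dots> \<le> F b" unfolding F_def
    proof (rule integral_mono)
      fix x
      have "\<bar>cos_comb M b x\<bar> - (K + K') \<le> \<phi> (f x - cos_comb M b x)"
        using coerc[of "f x - cos_comb M b x"] f(2)[of x] by linarith
      from mult_left_mono[OF this less_imp_le[OF weight_pos[of x]]]
      show "q x * \<bar>cos_comb M b x\<bar> - (K + K') * q x \<le> q x * \<phi> (f x - cos_comb M b x)"
        by (simp add: algebra_simps)
    qed (use i1 i2 weight_integrable in auto)
    finally show ?thesis using c(2)[OF that, of b] by simp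
  qed
  define R where "R = \<bar>F (\<lambda>_. 0) + K + K'\<bar> / c"
  have "R \<ge> 0" using c by (simp add: R_def)
  then have zero: "(\<lambda>_. 0) \<in> {a. \<forall>k. \<bar>a k\<bar> \<le> R}" by simp
  have "continuous_on {a. \<forall>k. \<bar>a k\<bar> \<le> R} F"
    unfolding F_def by (rule continuous_cost[OF \<phi> f])
  then obtain a where a: "\<And>b. b \<in> {a. \<forall>k. \<bar>a k\<bar> \<le> R} \<Longrightarrow> F a \<le> F b"
    using continuous_attains_inf[OF compact_coefficient_box, of R F] zero by blast
  have "F a \<le> F b" for b
  proof (cases "\<forall>k\<le>M. \<bar>b k\<bar> \<le> R")
    case True
    \<comment> \<open>The irrelevant coordinates of \<open>b\<close> may lie outside the box.\<close>
    define b' where "b' k = (if k \<le> M then b k else 0)" for k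
    have "F a \<le> F b'" using True \<open>R \<ge> 0\<close> by (intro a) (auto simp: b'_def)
    moreover have "cos_comb M b' x = cos_comb M b x" for x
      by (intro cos_comb_cong) (simp add: b'_def)
    ultimately show ?thesis by (simp add: F_def)
  next
    case False
    then obtain k where k: "k \<le> M" "R < \<bar>b k\<bar>" by auto
    then have "c * R < c * \<bar>b k\<bar>" using c by simp
    moreover have "F (\<lambda>_. 0) + (K + K') \<le> c * R" using c by (simp add: R_def)
    ultimately have "F (\<lambda>_. 0) \<le> F b" using lower[OF k(1), of b] by linarith
    then show ?thesis using a[OF zero] by linarith
  qed
  then show ?thesis using that unfolding F_def by blast
qed

text \<open>
  Euler--Lagrange equations of the minimisation problem, with \<open>\<psi>\<close> in the role of the derivative of \<open>\<phi>\<close>.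
  The quadratic upper bound on \<open>\<phi>\<close> replaces differentiation under the integral sign: moving the
  minimiser by \<open>t\<close> in the \<open>k\<close>-th direction changes the cost by at most \<open>- t\<close> times the \<open>k\<close>-th moment
  plus a multiple of \<open>t\<^sup>2\<close>.
\<close>
lemma residual_with_vanishing_moments:
  assumes \<phi>: "continuous_on UNIV (\<phi> :: real \<Rightarrow> real)" and coerc: "\<And>t. \<bar>t\<bar> - K' \<le> \<phi> t"
    and \<psi>: "continuous_on UNIV \<psi>" and descent: "\<And>s h. \<phi> (s + h) \<le> \<phi> s + h * \<psi> s + L * h\<^sup>2"
    and f: "f \<in> borel_measurable circle_measure" "\<And>x. \<bar>f x\<bar> \<le> K"
  obtains a where "preserves_moments q M (\<lambda>x. \<psi> (f x - cos_comb M a x))"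
proof -
  obtain a where a: "\<And>b. (\<integral>x. q x * \<phi> (f x - cos_comb M a x) \<partial>circle_measure)
                     \<le> (\<integral>x. q x * \<phi> (f x - cos_comb M b x) \<partial>circle_measure)"
    using cost_attains_min[OF \<phi> coerc f] by metis
  have "(\<integral>x. q x * \<psi> (f x - cos_comb M a x) * cos_vec k x \<partial>circle_measure) = 0" if k: "k \<le> M" for k
  proof (rule linear_le_square_imp_0)
    fix t :: real
    define r where "r x = f x - cos_comb M a x" for x
    define e where "e = (\<lambda>j. if j = k then 1 else 0 :: real)"
    have res: "f x - cos_comb M (\<lambda>j. a j + t * e j) x = r x + (- t) * cos_vec k x" for x
      unfolding cos_comb_add_scaled e_def cos_comb_unit[OF k] r_def by simp
    have cb: "\<bar>cos_vec k x\<bar> \<le> 1" "\<bar>(cos_vec k x)\<^sup>2\<bar> \<le> 1" for x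
      by (simp_all add: cos_vec_def abs_square_le_1 power_le_one)
    have i1: "integrable circle_measure (\<lambda>x. q x * \<phi> (f x - cos_comb M b x))" for b
      using integrable_cost[OF \<phi> f, of "\<lambda>_. 1" 1 M b] by simp
    have i2: "integrable circle_measure (\<lambda>x. q x * \<psi> (r x) * cos_vec k x)"
      using integrable_cost[OF \<psi> f, of "cos_vec k" 1 M a] cb by (simp add: r_def mult.assoc)
    have i3: "integrable circle_measure (\<lambda>x. q x * (cos_vec k x)\<^sup>2)"
      using cb by (intro integrable_weight_bounded[of _ 1]) auto
    define Q where "Q = (\<integral>x. q x * (cos_vec k x)\<^sup>2 \<partial>circle_measure)"
    have "(\<integral>x. q x * \<phi> (r x) \<partial>circle_measure)
            \<le> (\<integral>x. q x * \<phi> (f x - cos_comb M (\<lambda>j. a j + t * e j) x) \<partial>circle_measure)"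
      unfolding r_def by (rule a)
    also have "\<dots> \<le> (\<integral>x. q x * \<phi> (r x) - t * (q x * \<psi> (r x) * cos_vec k x)
                        + L * t\<^sup>2 * (q x * (cos_vec k x)\<^sup>2) \<partial>circle_measure)"
    proof (rule integral_mono)
      fix x
      have "q x * \<phi> (r x + (- t) * cos_vec k x)
        \<le> q x * (\<phi> (r x) + (- t) * cos_vec k x * \<psi> (r x) + L * ((- t) * cos_vec k x)\<^sup>2)"
        by (intro mult_left_mono descent less_imp_le weight_pos)
      then show "q x * \<phi> (f x - cos_comb M (\<lambda>j. a j + t * e j) x)
        \<le> q x * \<phi> (r x) - t * (q x * \<psi> (r x) * cos_vec k x) + L * t\<^sup>2 * (q x * (cos_vec k x)\<^sup>2)"
        unfolding res by (simp add: algebra_simps power2_eq_square)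
    qed (use i1 i1[of a, folded r_def] i2 i3 in auto)
    also have "\<dots> = (\<integral>x. q x * \<phi> (r x) \<partial>circle_measure)
        - t * (\<integral>x. q x * \<psi> (r x) * cos_vec k x \<partial>circle_measure) + L * t\<^sup>2 * Q"
      using i1[of a, folded r_def] i2 i3 unfolding Q_def by simp
    finally show "t * (\<integral>x. q x * \<psi> (f x - cos_comb M a x) * cos_vec k x \<partial>circle_measure)
                    \<le> (L * Q) * t\<^sup>2"
      unfolding r_def by (simp add: algebra_simps)
  qed
  then show ?thesis using that unfolding preserves_moments_def by blast
qed

section \<open>Square-integrable perturbations\<close>

lemma integrable_weight_L2_times_bounded:
  assumes [measurable]: "u \<in> borel_measurable circle_measure" "g \<in> borel_measurable circle_measure"
    and u2: "integrable circle_measure (\<lambda>x. q x * (u x)\<^sup>2)" and g: "\<And>x. \<bar>g x\<bar> \<le> K"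
  shows "integrable circle_measure (\<lambda>x. q x * u x * g x)"
proof (rule Bochner_Integration.integrable_bound)
  show "integrable circle_measure (\<lambda>x. K * (q x + q x * (u x)\<^sup>2))"
    using weight_integrable u2 by simp
  have "norm (q x * u x * g x) \<le> norm (K * (q x + q x * (u x)\<^sup>2))" for x
  proof -
    have "0 \<le> (\<bar>u x\<bar> - 1)\<^sup>2" by simp
    then have "2 * \<bar>u x\<bar> \<le> 1 + (u x)\<^sup>2" by (simp add: power2_diff)
    then have "\<bar>u x\<bar> \<le> 1 + (u x)\<^sup>2" by linarith
    then have "\<bar>u x\<bar> * \<bar>g x\<bar> \<le> (1 + (u x)\<^sup>2) * K"
      using g[of x] by (intro mult_mono) auto
    from mult_left_mono[OF this less_imp_le[OF weight_pos[of x]]]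
    have "q x * \<bar>u x\<bar> * \<bar>g x\<bar> \<le> K * (q x + q x * (u x)\<^sup>2)" by (simp add: algebra_simps)
    moreover have "0 \<le> K" using g[of x] by linarith
    ultimately show ?thesis using weight_pos[of x] by (simp add: abs_mult)
  qed
  then show "AE x in circle_measure. norm (q x * u x * g x) \<le> norm (K * (q x + q x * (u x)\<^sup>2))"
    by simp
  show "(\<lambda>x. q x * u x * g x) \<in> borel_measurable circle_measure" by measurable
qed

lemma moments_orthogonal_V:
  assumes u: "u \<in> borel_measurable circle_measure" "integrable circle_measure (\<lambda>x. q x * (u x)\<^sup>2)"
    and mom: "preserves_moments q M u" and "v \<in> V M"
  shows "(\<integral>x. q x * u x * v x \<partial>circle_measure) = 0"
proof -
  obtain a where v: "v = cos_comb M a" using assms(4) by (auto simp: V_def)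
  have "\<bar>cos_vec k x\<bar> \<le> 1" for k x by (simp add: cos_vec_def)
  then have "integrable circle_measure (\<lambda>x. q x * u x * cos_vec k x)" for k
    using u by (intro integrable_weight_L2_times_bounded[where K = 1]) auto
  moreover have "(\<integral>x. q x * u x * v x \<partial>circle_measure)
      = (\<integral>x. (\<Sum>k\<le>M. a k * (q x * u x * cos_vec k x)) \<partial>circle_measure)"
    by (simp add: v cos_comb_def sum_distrib_left algebra_simps)
  ultimately show ?thesis
    using mom by (simp add: preserves_moments_def)
qed

lemma L2_inner_self_nonneg: "0 \<le> L2_inner q g g"
  unfolding L2_inner_def
proof (rule integral_nonneg_AE, rule AE_I2)
  show "0 \<le> q x * g x * g x" for x
    unfolding mult.assoc by (rule mult_nonneg_nonneg) (simp_all add: weight_pos less_imp_le)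
qed

lemma L2_norm_square: "(L2_norm q g)\<^sup>2 = (\<integral>x. q x * (g x)\<^sup>2 \<partial>circle_measure)"
  using L2_inner_self_nonneg[of g]
  by (simp add: L2_norm_def L2_inner_def power2_eq_square mult.assoc)

text \<open>
  Cauchy--Schwarz from \<open>2 u g \<le> t u\<^sup>2 + g\<^sup>2 / t\<close>. Taking \<open>t\<close> slightly above the norm of \<open>g\<close> covers the
  case that this norm is zero.
\<close>
lemma integral_le_L2_norm:
  assumes u: "u \<in> borel_measurable circle_measure" "integrable circle_measure (\<lambda>x. q x * (u x)\<^sup>2)"
    and u1: "(\<integral>x. q x * (u x)\<^sup>2 \<partial>circle_measure) \<le> 1"
    and g: "g \<in> borel_measurable circle_measure" "\<And>x. \<bar>g x\<bar> \<le> K"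
  shows "(\<integral>x. q x * u x * g x \<partial>circle_measure) \<le> L2_norm q g"
proof (rule field_le_epsilon)
  fix e :: real assume "e > 0"
  have "(g x)\<^sup>2 \<le> K\<^sup>2" for x using g(2)[of x] by (metis abs_ge_zero power2_abs power_mono)
  then have g2: "integrable circle_measure (\<lambda>x. q x * (g x)\<^sup>2)"
    using g(1) by (intro integrable_weight_bounded[of _ "K\<^sup>2"]) auto
  define N where "N = (\<integral>x. q x * (g x)\<^sup>2 \<partial>circle_measure)"
  have "N \<ge> 0" unfolding N_def using weight_pos by (intro integral_nonneg_AE AE_I2) (simp add: less_imp_le)
  have Nn: "L2_norm q g = sqrt N" by (simp add: L2_norm_def L2_inner_def N_def power2_eq_square mult.assoc)
  define t where "t = sqrt N + e"
  have t: "t > 0" "N \<le> t\<^sup>2"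
    using \<open>e > 0\<close> \<open>N \<ge> 0\<close> by (auto simp: t_def power2_sum add_nonneg_pos)
  have "2 * (\<integral>x. q x * u x * g x \<partial>circle_measure) = (\<integral>x. 2 * (q x * u x * g x) \<partial>circle_measure)"
    by simp
  also have "\<dots> \<le> (\<integral>x. t * (q x * (u x)\<^sup>2) + 1 / t * (q x * (g x)\<^sup>2) \<partial>circle_measure)"
  proof (rule integral_mono)
    fix x
    have "0 \<le> (t * u x - g x)\<^sup>2 / t" using t by simp
    also have "\<dots> = t * (u x)\<^sup>2 + 1 / t * (g x)\<^sup>2 - 2 * (u x * g x)"
      using t by (simp add: power2_eq_square field_simps)
    finally have "2 * (u x * g x) \<le> t * (u x)\<^sup>2 + 1 / t * (g x)\<^sup>2" by simp
    from mult_left_mono[OF this less_imp_le[OF weight_pos[of x]]]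
    show "2 * (q x * u x * g x) \<le> t * (q x * (u x)\<^sup>2) + 1 / t * (q x * (g x)\<^sup>2)"
      by (simp add: algebra_simps)
  qed (use integrable_weight_L2_times_bounded[OF u(1) g(1) u(2) g(2)] u(2) g2 in auto)
  also have "\<dots> = t * (\<integral>x. q x * (u x)\<^sup>2 \<partial>circle_measure) + 1 / t * N"
    using u(2) g2 by (simp add: N_def)
  also have "\<dots> \<le> t * 1 + 1 / t * t\<^sup>2"
    using t u1 by (intro add_mono mult_left_mono) auto
  also have "\<dots> = 2 * t" using t by (simp add: power2_eq_square)
  finally show "(\<integral>x. q x * u x * g x \<partial>circle_measure) \<le> L2_norm q g + e"
    by (simp add: Nn t_def)
qed

section \<open>Residuals and the orthogonal projection\<close>

context
  fixes f :: "real \<Rightarrow> real" and K :: real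
  assumes per: "circle_fun f" and cont: "continuous_on UNIV f" and K: "\<And>x. \<bar>f x\<bar> \<le> K"
begin

lemma measurable_f [measurable]: "f \<in> borel_measurable circle_measure"
  using cont by (rule measurable_circle_of_continuous)

lemma residual_regular:
  assumes "v \<in> V M"
  shows "circle_fun (\<lambda>x. f x - v x)" "continuous_on UNIV (\<lambda>x. f x - v x)"
    "(\<lambda>x. f x - v x) \<in> borel_measurable circle_measure" "\<exists>C. \<forall>x. \<bar>f x - v x\<bar> \<le> C"
proof -
  obtain a where v: "v = cos_comb M a" using assms by (auto simp: V_def)
  show "circle_fun (\<lambda>x. f x - v x)"
    using per circle_fun_cos_comb[of M a] by (simp add: v circle_fun_iff)
  show c: "continuous_on UNIV (\<lambda>x. f x - v x)"
    unfolding v by (intro continuous_intros cont)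
  then show "(\<lambda>x. f x - v x) \<in> borel_measurable circle_measure"
    by (rule measurable_circle_of_continuous)
  have "\<bar>f x - v x\<bar> \<le> K + (\<Sum>k\<le>M. \<bar>a k\<bar>)" for x
    using K[of x] abs_cos_comb_le[of M a x] unfolding v by linarith
  then show "\<exists>C. \<forall>x. \<bar>f x - v x\<bar> \<le> C" by blast
qed

text \<open>
  Weak duality rests on this: a moment-preserving \<open>u\<close> does not see the \<open>V M\<close> part of the sensitivity.
\<close>
lemma response_eq_residual:
  assumes u: "u \<in> borel_measurable circle_measure" "integrable circle_measure (\<lambda>x. q x * (u x)\<^sup>2)"
    and mom: "preserves_moments q M u" and v: "v \<in> V M"
  shows "DR f (\<lambda>x. q x * u x) = (\<integral>x. q x * u x * (f x - v x) \<partial>circle_measure)"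
proof -
  obtain a where a: "v = cos_comb M a" using v by (auto simp: V_def)
  have "integrable circle_measure (\<lambda>x. q x * u x * f x)"
    using integrable_weight_L2_times_bounded[OF u(1) measurable_f u(2) K] .
  moreover have "integrable circle_measure (\<lambda>x. q x * u x * v x)"
    unfolding a using u abs_cos_comb_le[of M a]
    by (intro integrable_weight_L2_times_bounded) auto
  ultimately show ?thesis
    using moments_orthogonal_V[OF u mom v] by (simp add: DR_def right_diff_distrib)
qed

text \<open>
  Used with the square for the vanishing of \<open>B\<close> and with the absolute value for that of \<open>D\<close>.
\<close>
lemma residual_eq_0_of_integral:
  assumes v: "v \<in> V M" and "continuous_on UNIV \<phi>" "\<And>t::real. 0 \<le> (\<phi> t :: real)" "\<And>t. \<phi> t = 0 \<Longrightarrow> t = 0"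
    and z: "(\<integral>x. q x * \<phi> (f x - v x) \<partial>circle_measure) = 0"
  shows "f = v"
proof
  fix x
  obtain a where a: "v = cos_comb M a" using v by (auto simp: V_def)
  have "\<phi> (f x - v x) = 0"
  proof (rule weight_integral_eq_0D[of "\<lambda>x. \<phi> (f x - v x)"])
    show "circle_fun (\<lambda>x. \<phi> (f x - v x))"
      using residual_regular(1)[OF v] by (simp add: circle_fun_iff)
    show "continuous_on UNIV (\<lambda>x. \<phi> (f x - v x))"
      using continuous_on_compose2[OF assms(2) residual_regular(2)[OF v]] by simp
    show "integrable circle_measure (\<lambda>x. q x * \<phi> (f x - v x))"
      using integrable_cost[OF assms(2) measurable_f K, of "\<lambda>_. 1" 1 M a] by (simp add: a)
  qed (use assms in auto)
  then show "f x = v x" using assms(4) by fastforce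
qed

lemma orthogonal_projection_exists:
  obtains p where "p \<in> V M" "preserves_moments q M (\<lambda>x. f x - p x)"
proof -
  have "\<bar>t\<bar> - 1 \<le> t\<^sup>2" for t :: real
  proof -
    have "0 \<le> (\<bar>t\<bar> - 1)\<^sup>2" by simp
    then have "2 * \<bar>t\<bar> - 1 \<le> t\<^sup>2" by (simp add: power2_diff)
    then show ?thesis using abs_ge_zero[of t] by linarith
  qed
  moreover have "(s + h)\<^sup>2 \<le> s\<^sup>2 + h * (2 * s) + 1 * h\<^sup>2" for s h :: real
    by (simp add: power2_sum)
  moreover have "continuous_on UNIV (\<lambda>t::real. t\<^sup>2)" "continuous_on UNIV (\<lambda>t::real. 2 * t)"
    by (intro continuous_intros)+
  ultimately obtain a where "preserves_moments q M (\<lambda>x. 2 * (f x - cos_comb M a x))"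
    using residual_with_vanishing_moments[OF _ _ _ _ measurable_f K, of "\<lambda>t. t\<^sup>2" 1 "\<lambda>t. 2 * t" 1 M]
    by blast
  then have "preserves_moments q M (\<lambda>x. f x - cos_comb M a x)"
    by (simp only: preserves_moments_def mult.assoc mult.left_commute[of _ 2])
      (simp add: mult.assoc)
  with that show ?thesis using cos_comb_in_V by blast
qed

lemma residual_square_integrable:
  assumes "v \<in> V M" shows "integrable circle_measure (\<lambda>x. q x * (f x - v x)\<^sup>2)"
proof -
  obtain a where a: "v = cos_comb M a" using assms by (auto simp: V_def)
  show ?thesis
    using integrable_cost[OF _ measurable_f K, of "\<lambda>t. t\<^sup>2" "\<lambda>_. 1" 1 M a]
    by (simp add: a continuous_on_power continuous_on_id)
qed

lemma
  shows proj_V_in: "proj_V q M f \<in> V M"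
    and proj_V_moments: "preserves_moments q M (\<lambda>x. f x - proj_V q M f x)"
    and proj_V_eq: "f \<in> V M \<Longrightarrow> proj_V q M f = f"
proof -
  let ?P = "\<lambda>p. p \<in> V M \<and> (\<forall>v\<in>V M. L2_inner q (\<lambda>x. f x - p x) v = 0)"
  have orth: "?P p" if "p \<in> V M" "preserves_moments q M (\<lambda>x. f x - p x)" for p
    using moments_orthogonal_V[OF residual_regular(3)[OF that(1)] residual_square_integrable[OF that(1)] that(2)] that(1)
    by (simp add: L2_inner_def)
  obtain p where p: "p \<in> V M" "preserves_moments q M (\<lambda>x. f x - p x)"
    using orthogonal_projection_exists by blast
  have uniq: "p' = p" if p': "?P p'" for p'
  proof -
    obtain a a' where a: "p = cos_comb M a" "p' = cos_comb M a'" using p p' by (auto simp: V_def)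
    define w where "w = (\<lambda>x. p x - p' x)"
    have wV: "w \<in> V M" unfolding w_def using V_add_scaled[OF p(1), of p' "-1"] p' by simp
    then obtain b where b: "w = cos_comb M b" by (auto simp: V_def)
    have wb: "\<bar>w x\<bar> \<le> (\<Sum>k\<le>M. \<bar>b k\<bar>)" for x using abs_cos_comb_le by (simp add: b)
    have wm: "w \<in> borel_measurable circle_measure" by (simp add: b)
    have "integrable circle_measure (\<lambda>x. q x * (f x - v x) * w x)" if "v \<in> V M" for v
      using integrable_weight_L2_times_bounded[OF residual_regular(3)[OF that] wm residual_square_integrable[OF that] wb] .
    then have "(\<integral>x. q x * (f x - p' x) * w x - q x * (f x - p x) * w x \<partial>circle_measure) = 0"
      using p p' orth[OF p] wV by (simp add: L2_inner_def)
    also have "(\<lambda>x. q x * (f x - p' x) * w x - q x * (f x - p x) * w x) = (\<lambda>x. q x * (w x)\<^sup>2)"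
      by (simp add: w_def fun_eq_iff power2_eq_square algebra_simps)
    finally have z: "(\<integral>x. q x * (w x)\<^sup>2 \<partial>circle_measure) = 0" .
    have "(w x)\<^sup>2 = 0" for x
    proof (rule weight_integral_eq_0D[of "\<lambda>x. (w x)\<^sup>2"])
      show "circle_fun (\<lambda>x. (w x)\<^sup>2)" using circle_fun_cos_comb[of M b] by (simp add: b circle_fun_iff)
      show "continuous_on UNIV (\<lambda>x. (w x)\<^sup>2)" unfolding b by (intro continuous_intros)
      have "\<bar>(w x)\<^sup>2\<bar> \<le> (\<Sum>k\<le>M. \<bar>b k\<bar>)\<^sup>2" for x
        using wb[of x] by (metis abs_ge_zero abs_power2 power2_abs power_mono)
      then show "integrable circle_measure (\<lambda>x. q x * (w x)\<^sup>2)"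
        using wm by (intro integrable_weight_bounded) auto
    qed (use z in auto)
    then show ?thesis by (simp add: w_def fun_eq_iff)
  qed
  have "proj_V q M f = p" unfolding proj_V_def
    by (rule the_equality) (rule orth[OF p], erule uniq)
  then show "proj_V q M f \<in> V M" "preserves_moments q M (\<lambda>x. f x - proj_V q M f x)"
    using p by auto
  show "proj_V q M f = f" if "f \<in> V M"
    using \<open>proj_V q M f = p\<close> uniq[of f] that by (simp add: L2_inner_def)
qed

section \<open>Duality in the mean square\<close>

lemma B_nonneg: "0 \<le> B q f M"
  by (simp add: B_def L2_norm_def L2_inner_self_nonneg)

lemma L2_response_le:
  assumes "u \<in> L2 q" "preserves_moments q M u" "L2_norm q u \<le> 1" "v \<in> V M"
  shows "DR f (\<lambda>x. q x * u x) \<le> L2_norm q (\<lambda>x. f x - v x)"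
proof -
  have u: "u \<in> borel_measurable circle_measure" "integrable circle_measure (\<lambda>x. q x * (u x)\<^sup>2)"
    using assms(1) by (auto simp: L2_def)
  have nn: "0 \<le> L2_inner q u u" by (rule L2_inner_self_nonneg)
  have "(\<integral>x. q x * (u x)\<^sup>2 \<partial>circle_measure) \<le> 1"
    using assms(3) L2_norm_square[of u] nn
    by (metis L2_norm_def power_le_one real_sqrt_ge_zero)
  then show ?thesis
    unfolding response_eq_residual[OF u assms(2,4)]
    using integral_le_L2_norm[OF u] residual_regular(3,4)[OF assms(4)] by blast
qed

text \<open>
  The maximiser is the residual of the projection, normalised. When the residual has norm zero, the
  supremum is attained at 0.
\<close>
lemma L2_response_attained:
  obtains u where "u \<in> L2 q" "preserves_moments q M u" "L2_norm q u \<le> 1"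
    "DR f (\<lambda>x. q x * u x) = B q f M"
proof (cases "B q f M = 0")
  case True
  have "(\<lambda>x. 0) \<in> L2 q" by (simp add: L2_def circle_fun_iff)
  then show ?thesis
    using that[of "\<lambda>x. 0"] True
    by (simp add: preserves_moments_def L2_norm_def L2_inner_def DR_def)
next
  case False
  define r where "r x = f x - proj_V q M f x" for x
  define b where "b = B q f M"
  have b: "b > 0" using False B_nonneg[of M] by (simp add: b_def)
  have b2: "b\<^sup>2 = (\<integral>x. q x * (r x)\<^sup>2 \<partial>circle_measure)"
    unfolding b_def B_def L2_norm_square r_def ..
  note rf = residual_regular[OF proj_V_in, of M, folded r_def]
  have r2: "integrable circle_measure (\<lambda>x. q x * (r x)\<^sup>2)"
    using residual_square_integrable[OF proj_V_in] by (simp add: r_def)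
  define u where "u x = r x / b" for x
  have u2: "(\<lambda>x. q x * (u x)\<^sup>2) = (\<lambda>x. q x * (r x)\<^sup>2 / b\<^sup>2)"
    by (simp add: u_def power_divide)
  have um: "u \<in> borel_measurable circle_measure" unfolding u_def using rf(3) by simp
  have ui: "integrable circle_measure (\<lambda>x. q x * (u x)\<^sup>2)" unfolding u2 using r2 by simp
  have mom: "preserves_moments q M u"
    using proj_V_moments[of M] unfolding preserves_moments_def u_def r_def by simp
  show ?thesis
  proof (rule that)
    show "u \<in> L2 q"
      using rf(1) um ui by (simp add: L2_def circle_fun_iff u_def)
    have "(L2_norm q u)\<^sup>2 = 1"
      unfolding L2_norm_square u2 using b by (simp flip: b2)
    then show "L2_norm q u \<le> 1" by (simp add: power2_eq_1_iff) linarith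
    have "DR f (\<lambda>x. q x * u x) = (\<integral>x. q x * (r x)\<^sup>2 / b \<partial>circle_measure)"
      unfolding response_eq_residual[OF um ui mom proj_V_in]
      by (simp add: u_def r_def power2_eq_square mult.assoc)
    also have "\<dots> = b\<^sup>2 / b" by (simp add: b2)
    also have "\<dots> = b" by (simp add: power2_eq_square)
    finally show "DR f (\<lambda>x. q x * u x) = B q f M" by (simp add: b_def)
  qed (rule mom)
qed

lemma L2_duality:
  "(SUP u\<in>{u \<in> L2 q. preserves_moments q M u \<and> L2_norm q u \<le> 1}.
      ereal (DR f (\<lambda>x. q x * u x))) = ereal (B q f M)"
proof (rule antisym)
  show "(SUP u\<in>{u \<in> L2 q. preserves_moments q M u \<and> L2_norm q u \<le> 1}.
      ereal (DR f (\<lambda>x. q x * u x))) \<le> ereal (B q f M)"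
    using L2_response_le[OF _ _ _ proj_V_in] by (auto intro!: SUP_least simp: B_def)
  obtain u where "u \<in> L2 q" "preserves_moments q M u" "L2_norm q u \<le> 1"
    "DR f (\<lambda>x. q x * u x) = B q f M" by (rule L2_response_attained)
  then show "ereal (B q f M) \<le> (SUP u\<in>{u \<in> L2 q. preserves_moments q M u \<and> L2_norm q u \<le> 1}.
      ereal (DR f (\<lambda>x. q x * u x)))"
    by (intro SUP_upper2[of u]) auto
qed

lemma B_le: "v \<in> V M \<Longrightarrow> B q f M \<le> L2_norm q (\<lambda>x. f x - v x)"
proof -
  assume v: "v \<in> V M"
  obtain u where "u \<in> L2 q" "preserves_moments q M u" "L2_norm q u \<le> 1"
    "DR f (\<lambda>x. q x * u x) = B q f M" by (rule L2_response_attained)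
  then show ?thesis using L2_response_le[of u M v] v by simp
qed

section \<open>Duality for bounded perturbations\<close>

lemma residual_abs_integrable:
  "integrable circle_measure (\<lambda>x. q x * \<bar>f x - cos_comb M a x\<bar>)"
  using integrable_cost[OF _ measurable_f K, of abs "\<lambda>_. 1" 1 M a]
  by (simp add: continuous_on_rabs continuous_on_id)

lemma D_le: "D q f M \<le> (\<integral>x. q x * \<bar>f x - cos_comb M a x\<bar> \<partial>circle_measure)"
  unfolding D_def by (rule cINF_lower[OF bdd_belowI2[of _ 0]]) (rule weight_integral_abs_nonneg UNIV_I)+

lemma D_attained: obtains a where "D q f M = (\<integral>x. q x * \<bar>f x - cos_comb M a x\<bar> \<partial>circle_measure)"
proof -
  obtain a where a: "\<And>b. (\<integral>x. q x * \<bar>f x - cos_comb M a x\<bar> \<partial>circle_measure)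
                    \<le> (\<integral>x. q x * \<bar>f x - cos_comb M b x\<bar> \<partial>circle_measure)"
  proof (rule cost_attains_min[OF _ _ measurable_f K, of abs 0 M])
    show "continuous_on UNIV (\<lambda>t::real. \<bar>t\<bar>)" by (intro continuous_intros)
    show "\<bar>t\<bar> - 0 \<le> \<bar>t\<bar>" for t :: real by simp
  qed (rule that)
  have "(\<integral>x. q x * \<bar>f x - cos_comb M a x\<bar> \<partial>circle_measure) \<le> D q f M"
    unfolding D_def by (rule cINF_greatest) (simp_all add: a)
  with D_le[of M a] have "D q f M = (\<integral>x. q x * \<bar>f x - cos_comb M a x\<bar> \<partial>circle_measure)"
    by (rule antisym)
  then show ?thesis by (rule that)
qed

lemma D_nonneg: "0 \<le> D q f M"
proof -
  obtain a where "D q f M = (\<integral>x. q x * \<bar>f x - cos_comb M a x\<bar> \<partial>circle_measure)"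
    by (rule D_attained)
  then show ?thesis using weight_integral_abs_nonneg by simp
qed

lemma Linf_unit_ball_AE:
  assumes "Linf_norm u \<le> 1" shows "AE x in circle_measure. \<bar>u x\<bar> \<le> 1"
  using esssup_AE[of "\<lambda>x. ereal \<bar>u x\<bar>" circle_measure]
proof eventually_elim
  case (elim x)
  then have "ereal \<bar>u x\<bar> \<le> 1" using assms unfolding Linf_norm_def by (rule order_trans)
  then show ?case by simp
qed

lemma Linf_response_le:
  assumes "u \<in> Linf" "preserves_moments q M u" "Linf_norm u \<le> 1"
  shows "DR f (\<lambda>x. q x * u x) \<le> (\<integral>x. q x * \<bar>f x - cos_comb M a x\<bar> \<partial>circle_measure)"
proof -
  have um: "u \<in> borel_measurable circle_measure" using assms(1) by (simp add: Linf_def)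
  note ae = Linf_unit_ball_AE[OF assms(3)]
  have "AE x in circle_measure. \<bar>(u x)\<^sup>2\<bar> \<le> 1"
    using ae by eventually_elim (simp add: abs_square_le_1)
  then have ui: "integrable circle_measure (\<lambda>x. q x * (u x)\<^sup>2)"
    using um by (intro integrable_weight_bounded) auto
  let ?r = "\<lambda>x. f x - cos_comb M a x"
  have v: "cos_comb M a \<in> V M" by (rule cos_comb_in_V)
  show ?thesis
    unfolding response_eq_residual[OF um ui assms(2) v]
  proof (rule integral_mono_AE)
    obtain C where "\<And>x. \<bar>?r x\<bar> \<le> C" using residual_regular(4)[OF v] by blast
    then show "integrable circle_measure (\<lambda>x. q x * u x * ?r x)"
      by (intro integrable_weight_L2_times_bounded[OF um residual_regular(3)[OF v] ui])
    show "integrable circle_measure (\<lambda>x. q x * \<bar>?r x\<bar>)" by (rule residual_abs_integrable)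
    show "AE x in circle_measure. q x * u x * ?r x \<le> q x * \<bar>?r x\<bar>"
      using ae
    proof eventually_elim
      case (elim x)
      have "u x * ?r x \<le> \<bar>u x\<bar> * \<bar>?r x\<bar>" by (metis abs_ge_self abs_mult)
      also have "\<dots> \<le> \<bar>?r x\<bar>" using elim by (simp add: mult_left_le_one_le)
      finally show ?case using weight_pos[of x] by (simp add: mult.assoc)
    qed
  qed
qed

text \<open>
  The maximiser of the formal problem is the sign of a best residual. Here the sign is smoothed to
  \<open>t / sqrt (e\<^sup>2 + t\<^sup>2)\<close>, the derivative of \<open>sqrt (e\<^sup>2 + t\<^sup>2)\<close>, and the residual is taken at a minimiser
  of the smoothed \<open>L\<^sup>1\<close> cost, so that the moments vanish exactly and only the response loses \<open>e\<close>.
\<close>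
lemma Linf_response_near:
  assumes "e > 0"
  obtains u where "u \<in> Linf" "preserves_moments q M u" "Linf_norm u \<le> 1"
    "D q f M - e \<le> DR f (\<lambda>x. q x * u x)"
proof -
  define \<psi> where "\<psi> t = t / sqrt (e\<^sup>2 + t\<^sup>2)" for t :: real
  have pos: "0 < e\<^sup>2 + t\<^sup>2" for t :: real using assms by (simp add: add_pos_nonneg)
  have \<psi>: "continuous_on UNIV \<psi>"
    unfolding \<psi>_def using pos by (intro continuous_intros) (metis real_sqrt_eq_zero_cancel_iff less_irrefl)
  have abs_le: "\<bar>t\<bar> \<le> sqrt (e\<^sup>2 + t\<^sup>2)" for t by (rule real_le_rsqrt) simp
  have \<psi>1: "\<bar>\<psi> t\<bar> \<le> 1" for t
    using abs_le[of t] pos[of t] by (simp add: \<psi>_def)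
  \<comment> \<open>With \<open>S = sqrt (e\<^sup>2 + t\<^sup>2)\<close> the right side is \<open>S - e\<^sup>2 / S\<close>, and \<open>e \<le> S\<close>.\<close>
  have \<psi>t: "\<bar>t\<bar> - e \<le> \<psi> t * t" for t
  proof -
    define S where "S = sqrt (e\<^sup>2 + t\<^sup>2)"
    have S: "S > 0" "S\<^sup>2 = e\<^sup>2 + t\<^sup>2" using pos[of t] by (simp_all add: S_def)
    have "e \<le> S" unfolding S_def by (rule real_le_rsqrt) simp
    then have "e\<^sup>2 / S \<le> e" using S assms by (simp add: power2_eq_square field_simps)
    moreover have "\<psi> t * t = S - e\<^sup>2 / S"
      using S by (simp add: \<psi>_def flip: S_def) (simp add: field_simps power2_eq_square)
    moreover have "\<bar>t\<bar> \<le> S" unfolding S_def by (rule abs_le)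
    ultimately show ?thesis by linarith
  qed
  obtain a where mom: "preserves_moments q M (\<lambda>x. \<psi> (f x - cos_comb M a x))"
  proof (rule residual_with_vanishing_moments[OF _ _ \<psi> _ measurable_f K,
          of "\<lambda>t. sqrt (e\<^sup>2 + t\<^sup>2)" 0 "1 / (2 * e)" M])
    show "continuous_on UNIV (\<lambda>t. sqrt (e\<^sup>2 + t\<^sup>2))" by (intro continuous_intros)
    show "sqrt (e\<^sup>2 + (s + h)\<^sup>2) \<le> sqrt (e\<^sup>2 + s\<^sup>2) + h * \<psi> s + 1 / (2 * e) * h\<^sup>2" for s h
      unfolding \<psi>_def by (rule sqrt_smoothing_descent[OF assms])
    show "\<bar>t\<bar> - 0 \<le> sqrt (e\<^sup>2 + t\<^sup>2)" for t using abs_le by simp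
  qed (rule that)
  define r where "r x = f x - cos_comb M a x" for x
  define u where "u x = \<psi> (r x)" for x
  note rf = residual_regular[OF cos_comb_in_V, of M a, folded r_def]
  have um: "u \<in> borel_measurable circle_measure"
    unfolding u_def by (rule measurable_comp_continuous[OF \<psi> rf(3)])
  have u1: "\<bar>u x\<bar> \<le> 1" for x by (simp add: u_def \<psi>1)
  have ui: "integrable circle_measure (\<lambda>x. q x * (u x)\<^sup>2)"
    using um u1 by (intro integrable_weight_bounded[of _ 1]) (auto simp: abs_square_le_1)
  have umom: "preserves_moments q M u" using mom unfolding u_def r_def .
  have norm: "Linf_norm u \<le> 1"
    unfolding Linf_norm_def using um u1 by (intro esssup_I) auto
  show ?thesis
  proof (rule that)
    show "u \<in> Linf"
      using um rf(1) norm by (auto simp: Linf_def circle_fun_iff u_def)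
    have ri: "integrable circle_measure (\<lambda>x. q x * \<bar>r x\<bar>)"
      unfolding r_def by (rule residual_abs_integrable)
    obtain C where C: "\<And>x. \<bar>r x\<bar> \<le> C" using rf(4) by blast
    have "D q f M - e \<le> (\<integral>x. q x * \<bar>r x\<bar> \<partial>circle_measure) - e"
      using D_le[of M a] by (simp add: r_def)
    also have "\<dots> = (\<integral>x. q x * \<bar>r x\<bar> - e * q x \<partial>circle_measure)"
      using ri weight_integrable weight_integral by simp
    also have "\<dots> \<le> (\<integral>x. q x * u x * r x \<partial>circle_measure)"
    proof (rule integral_mono)
      fix x
      show "q x * \<bar>r x\<bar> - e * q x \<le> q x * u x * r x"
        using mult_left_mono[OF \<psi>t[of "r x"] less_imp_le[OF weight_pos[of x]]]
        by (simp add: u_def algebra_simps)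
    qed (use ri weight_integrable integrable_weight_L2_times_bounded[OF um rf(3) ui C] in auto)
    also have "\<dots> = DR f (\<lambda>x. q x * u x)"
      using response_eq_residual[OF um ui umom cos_comb_in_V] by (simp add: r_def)
    finally show "D q f M - e \<le> DR f (\<lambda>x. q x * u x)" .
  qed (use norm umom in auto)
qed

lemma Linf_duality:
  "(SUP u\<in>{u \<in> Linf. preserves_moments q M u \<and> Linf_norm u \<le> 1}.
      ereal (DR f (\<lambda>x. q x * u x))) = ereal (D q f M)" (is "?S = _")
proof (rule antisym)
  obtain a where "D q f M = (\<integral>x. q x * \<bar>f x - cos_comb M a x\<bar> \<partial>circle_measure)"
    by (rule D_attained)
  then show "?S \<le> ereal (D q f M)"
    using Linf_response_le[of _ M a] by (auto intro!: SUP_least)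
  show "ereal (D q f M) \<le> ?S"
  proof (rule ereal_le_epsilon2)
    fix e :: real assume "0 < e"
    then obtain u where u: "u \<in> Linf" "preserves_moments q M u" "Linf_norm u \<le> 1"
      "D q f M - e \<le> DR f (\<lambda>x. q x * u x)" by (rule Linf_response_near)
    then have "ereal (DR f (\<lambda>x. q x * u x)) \<le> ?S" by (intro SUP_upper) auto
    then have "ereal (DR f (\<lambda>x. q x * u x)) + ereal e \<le> ?S + ereal e" by (rule add_right_mono)
    moreover have "ereal (D q f M) \<le> ereal (DR f (\<lambda>x. q x * u x)) + ereal e" using u(4) by simp
    ultimately show "ereal (D q f M) \<le> ?S + ereal e" by (rule order_trans[rotated])
  qed
qed

section \<open>Vanishing, monotonicity and convergence\<close>

lemma D_le_B: "D q f M \<le> B q f M"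
proof -
  obtain a where a: "proj_V q M f = cos_comb M a" using proj_V_in by (force simp: V_def)
  let ?r = "\<lambda>x. \<bar>f x - cos_comb M a x\<bar>"
  note rf = residual_regular[OF cos_comb_in_V, of M a]
  obtain C where C: "\<And>x. \<bar>f x - cos_comb M a x\<bar> \<le> C" using rf(4) by blast
  have "D q f M \<le> (\<integral>x. q x * 1 * ?r x \<partial>circle_measure)" using D_le by simp
  also have "\<dots> \<le> L2_norm q ?r"
    using weight_integrable weight_integral rf(3) C
    by (intro integral_le_L2_norm[where K = C]) simp_all
  also have "\<dots> = B q f M" by (simp add: B_def a L2_norm_def L2_inner_def mult.assoc)
  finally show ?thesis .
qed

lemma B_eq_0_iff: "B q f M = 0 \<longleftrightarrow> f \<in> V M"
proof
  assume "B q f M = 0"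
  then have z: "(\<integral>x. q x * (f x - proj_V q M f x)\<^sup>2 \<partial>circle_measure) = 0"
    unfolding L2_norm_square[symmetric] B_def by simp
  have "continuous_on UNIV (\<lambda>t::real. t\<^sup>2)" by (intro continuous_intros)
  from residual_eq_0_of_integral[OF proj_V_in this _ _ z] have "f = proj_V q M f" by simp
  then show "f \<in> V M" using proj_V_in[of M] by simp
next
  assume "f \<in> V M"
  then show "B q f M = 0" by (simp add: B_def proj_V_eq L2_norm_def L2_inner_def)
qed

lemma D_eq_0_iff: "D q f M = 0 \<longleftrightarrow> f \<in> V M"
proof
  assume "D q f M = 0"
  moreover obtain a where "D q f M = (\<integral>x. q x * \<bar>f x - cos_comb M a x\<bar> \<partial>circle_measure)"
    by (rule D_attained)
  ultimately have z: "(\<integral>x. q x * \<bar>f x - cos_comb M a x\<bar> \<partial>circle_measure) = 0" by simp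
  have "continuous_on UNIV (\<lambda>t::real. \<bar>t\<bar>)" by (intro continuous_intros)
  from residual_eq_0_of_integral[OF cos_comb_in_V this _ _ z] have "f = cos_comb M a" by simp
  then show "f \<in> V M" by (simp add: cos_comb_in_V)
next
  assume "f \<in> V M"
  then show "D q f M = 0" using B_eq_0_iff[of M] D_le_B[of M] D_nonneg[of M] by simp
qed

text \<open>
  Through the duality formula: a larger \<open>M\<close> imposes more constraints on \<open>u\<close>, so the supremum runs over
  a smaller set.
\<close>
lemma decseq_B: "decseq (B q f)"
proof (rule antimonoI)
  fix M N :: nat assume "M \<le> N"
  then have "ereal (B q f N) \<le> ereal (B q f M)"
    unfolding L2_duality[symmetric] by (intro SUP_subset_mono) (auto intro: preserves_moments_antimono)
  then show "B q f N \<le> B q f M" by simp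
qed

lemma decseq_D: "decseq (D q f)"
proof (rule antimonoI)
  fix M N :: nat assume "M \<le> N"
  then have "ereal (D q f N) \<le> ereal (D q f M)"
    unfolding Linf_duality[symmetric] by (intro SUP_subset_mono) (auto intro: preserves_moments_antimono)
  then show "D q f N \<le> D q f M" by simp
qed

lemma B_tendsto_0:
  assumes even: "\<And>x. f (- x) = f x"
  shows "B q f \<longlonglongrightarrow> 0"
proof (rule LIMSEQ_I)
  fix e :: real assume "0 < e"
  then obtain N v where v: "v \<in> V N" "\<And>x. x \<in> {-pi..pi} \<Longrightarrow> \<bar>f x - v x\<bar> < e / 2"
    using V_dense_even[OF cont even half_gt_zero] by metis
  have "(L2_norm q (\<lambda>x. f x - v x))\<^sup>2 \<le> (e / 2)\<^sup>2"
    unfolding L2_norm_square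
  proof (rule weight_integral_bound)
    fix x assume "x \<in> {-pi..pi}"
    then have "\<bar>f x - v x\<bar> \<le> e / 2" using v(2) by fastforce
    then show "\<bar>(f x - v x)\<^sup>2\<bar> \<le> (e / 2)\<^sup>2"
      by (metis abs_ge_zero abs_power2 power2_abs power_mono)
  qed (use residual_regular(3)[OF v(1)] in simp)
  then have "L2_norm q (\<lambda>x. f x - v x) \<le> e / 2"
    by (rule power2_le_imp_le) (use \<open>0 < e\<close> in simp)
  then have "B q f N \<le> e / 2" using B_le[OF v(1)] by linarith
  then have "norm (B q f n - 0) < e" if "N \<le> n" for n
    using decseqD[OF decseq_B that] B_nonneg[of n] \<open>0 < e\<close> by simp
  then show "\<exists>N. \<forall>n\<ge>N. norm (B q f n - 0) < e" by blast
qed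

end

end

theorem propositionS10:
  fixes q0 \<Psi> :: "real \<Rightarrow> real"
  assumes "even_density q0"
    and "circle_fun \<Psi>" and "continuous_on UNIV \<Psi>" and "bounded (range \<Psi>)"
    and "\<forall>x. \<Psi> (- x) = \<Psi> x"
  shows "(\<forall>M. (SUP u\<in>{u \<in> L2 q0. preserves_moments q0 M u \<and> L2_norm q0 u \<le> 1}.
                  ereal (DR \<Psi> (\<lambda>x. q0 x * u x))) = ereal (B q0 \<Psi> M))
       \<and> (\<forall>M. (SUP u\<in>{u \<in> Linf. preserves_moments q0 M u \<and> Linf_norm u \<le> 1}.
                  ereal (DR \<Psi> (\<lambda>x. q0 x * u x))) = ereal (D q0 \<Psi> M))
       \<and> (\<forall>M. B q0 \<Psi> M = 0 \<longleftrightarrow> \<Psi> \<in> V M)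
       \<and> (\<forall>M. D q0 \<Psi> M = 0 \<longleftrightarrow> \<Psi> \<in> V M)
       \<and> (\<forall>M. D q0 \<Psi> M \<le> B q0 \<Psi> M)
       \<and> decseq (B q0 \<Psi>) \<and> decseq (D q0 \<Psi>)
       \<and> B q0 \<Psi> \<longlonglongrightarrow> 0"
proof -
  obtain K where K: "\<And>x. \<bar>\<Psi> x\<bar> \<le> K"
    using assms(4) by (auto simp: bounded_iff)
  note facts = assms(1-3) K
  show ?thesis
    using L2_duality[OF facts] Linf_duality[OF facts] B_eq_0_iff[OF facts] D_eq_0_iff[OF facts]
      D_le_B[OF facts] decseq_B[OF facts] decseq_D[OF facts] B_tendsto_0[OF facts] assms(5)
    by simp
qed

end
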